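(* Let $Z^0$ be the set of minimizers of $g$ over $\Delta_0$. Then $Z^0\neq\varnothing$. Moreover, given $q^0\in\mathrm{ri}(\Delta_0)$ (relative interior), consider the sequence $(q^n)_{n\in\mathbb{N}}$ generated by the recurrence $$(\forall n\in\mathbb{N})(\forall s\in S)(\forall(a,b)\in I^s)\quad q_{ab}^{n+1,s}=\frac{(T_0(q^n))_b}{\sum_{(a',b')\in I^s}(T_0(q^n))_{b'}},$$ where $T_0:\Delta_0\to\Delta(B)$ is defined by $$T_0(q)=\Big(\sum_{s\in S}p_s\sum_{a\in I_b^s}q_{ab}^s\Big)_{b\in B}.$$ Then there is some $\overline{q}\in Z^0$ such that $q^n\to\overline{q}$ and $g(q^n)-g(\overline{q})=O(1/n)$.
   Context: $A,B,S$ are nonempty finite sets with $|A|\ge2$, $(c_{ab}^s)_{a\in A,b\in B,s\in S}$ are real cost values, and $p=(p_s)_{s\in S}$ is a probability distribution on $S$ with $p_s>0$ for all $s$. For a nonempty finite set $I$, $\Delta(I)=\{x\in[0,1]^I:\sum_{i\in I}x_i=1\}$. For $s\in S$, $c_{\min}^s=\min_{(a,b)\in A\times B}c_{ab}^s$ and $c_{\max}^s=\max_{(a,b)\in A\times B}c_{ab}^s$; $c_{\min}=\sum_{s\in S}p_sc_{\min}^s$ and $c_{\max}=\sum_{s\in S}p_sc_{\max}^s$. Standing assumption: $c_{\min}^s=0$ for all $s\in S$, and $c_{\max}>c_{\min}$. For $s\in S$ and $b\in B$: $I^s=\{(a,b)\in A\times B: c_{ab}^s=c_{\min}^s\}$,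 $I_b^s=\{a\in A:c_{ab}^s=c_{\min}^s\}$, and $\Delta_0=\prod_{s\in S}\Delta(I^s)$. Elements of $\Delta_0$ are identified with elements of $(\Delta(A\times B))^S$ by setting $q_{ab}^s=0$ for $(a,b)\notin I^s$. The components of $q^n$ are written $q_{ab}^{n,s}$. Define $\psi:\mathbb{R}^2\to\,]-\infty,+\infty]$ by $\psi(\xi,\mu)=\xi\ln(\xi/\mu)$ if $\xi>0$ and $\mu>0$; $\psi(0,\mu)=0$ if $\mu\ge0$; and $+\infty$ otherwise. The function $g:(\mathbb{R}^{A\times B})^S\to\,]-\infty,+\infty]$ is $$g(q)=\sum_{s\in S}p_s\sum_{a\in A}\sum_{b\in B}\psi\Big(q_{ab}^s,\sum_{a'\in A}\sum_{s'\in S}p_{s'}q_{a'b}^{s'}\Big)$$ if all components of $q$ are nonnegative, and $g(q)=+\infty$ otherwise. *)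

theory Defs
  imports "HOL-Analysis.Analysis" "HOL-Library.Landau_Symbols"
begin

text \<open>
  The finite sets \<open>A\<close>, \<open>B\<close>, \<open>S\<close> are the types \<open>'a\<close>, \<open>'b\<close>, \<open>'s\<close> of class \<open>finite\<close>;
  \<open>c s a b\<close> is the cost \<open>c\<^sub>a\<^sub>b\<^sup>s\<close>, and \<open>q $ s $ (a, b)\<close> is \<open>q\<^sub>a\<^sub>b\<^sup>s\<close>.
\<close>

type_synonym ('a, 'b, 's) family = "(real ^ ('a \<times> 'b)) ^ 's"

definition cmin_at :: "('s \<Rightarrow> 'a::finite \<Rightarrow> 'b::finite \<Rightarrow> real) \<Rightarrow> 's \<Rightarrow> real" where
  "cmin_at c s = Min (range (\<lambda>(a, b). c s a b))"

definition cmax_at :: "('s \<Rightarrow> 'a::finite \<Rightarrow> 'b::finite \<Rightarrow> real) \<Rightarrow> 's \<Rightarrow> real" where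
  "cmax_at c s = Max (range (\<lambda>(a, b). c s a b))"

definition cmin :: "('s::finite \<Rightarrow> 'a::finite \<Rightarrow> 'b::finite \<Rightarrow> real) \<Rightarrow> ('s \<Rightarrow> real) \<Rightarrow> real" where
  "cmin c p = (\<Sum>s\<in>UNIV. p s * cmin_at c s)"

definition cmax :: "('s::finite \<Rightarrow> 'a::finite \<Rightarrow> 'b::finite \<Rightarrow> real) \<Rightarrow> ('s \<Rightarrow> real) \<Rightarrow> real" where
  "cmax c p = (\<Sum>s\<in>UNIV. p s * cmax_at c s)"

definition opt_pairs :: "('s \<Rightarrow> 'a::finite \<Rightarrow> 'b::finite \<Rightarrow> real) \<Rightarrow> 's \<Rightarrow> ('a \<times> 'b) set" where
  "opt_pairs c s = {(a, b). c s a b = cmin_at c s}"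

definition opt_actions :: "('s \<Rightarrow> 'a::finite \<Rightarrow> 'b::finite \<Rightarrow> real) \<Rightarrow> 's \<Rightarrow> 'b \<Rightarrow> 'a set" where
  "opt_actions c s b = {a. c s a b = cmin_at c s}"

text \<open>
  \<open>\<Delta>(I)\<close> for a subset \<open>I\<close> of a finite index type, embedded in the full coordinate space by
  extending with zeros outside \<open>I\<close>.
\<close>

definition simplex_on :: "'i::finite set \<Rightarrow> (real ^ 'i) set" where
  "simplex_on I =
     {x. (\<forall>i\<in>I. 0 \<le> x $ i \<and> x $ i \<le> 1) \<and> (\<Sum>i\<in>I. x $ i) = 1 \<and> (\<forall>i. i \<notin> I \<longrightarrow> x $ i = 0)}"

definition Delta0 :: "('s::finite \<Rightarrow> 'a::finite \<Rightarrow> 'b::finite \<Rightarrow> real) \<Rightarrow> ('a, 'b, 's) family set" where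
  "Delta0 c = {q. \<forall>s. q $ s \<in> simplex_on (opt_pairs c s)}"

definition psi :: "real \<Rightarrow> real \<Rightarrow> ereal" where
  "psi \<xi> \<mu> =
     (if \<xi> > 0 \<and> \<mu> > 0 then ereal (\<xi> * ln (\<xi> / \<mu>))
      else if \<xi> = 0 \<and> \<mu> \<ge> 0 then 0
      else \<infinity>)"

definition g :: "('s::finite \<Rightarrow> real) \<Rightarrow> ('a::finite, 'b::finite, 's) family \<Rightarrow> ereal" where
  "g p q =
     (if \<forall>s a b. q $ s $ (a, b) \<ge> 0
      then \<Sum>s\<in>UNIV. ereal (p s) *
             (\<Sum>a\<in>UNIV. \<Sum>b\<in>UNIV.
                psi (q $ s $ (a, b)) (\<Sum>a'\<in>UNIV. \<Sum>s'\<in>UNIV. p s' * q $ s' $ (a', b)))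
      else \<infinity>)"

definition Z0 ::
  "('s::finite \<Rightarrow> 'a::finite \<Rightarrow> 'b::finite \<Rightarrow> real) \<Rightarrow> ('s \<Rightarrow> real) \<Rightarrow> ('a, 'b, 's) family set" where
  "Z0 c p = {q. is_arg_min (g p) (\<lambda>q. q \<in> Delta0 c) q}"

definition T0 ::
  "('s::finite \<Rightarrow> 'a::finite \<Rightarrow> 'b::finite \<Rightarrow> real) \<Rightarrow> ('s \<Rightarrow> real) \<Rightarrow>
   ('a, 'b, 's) family \<Rightarrow> real ^ 'b" where
  "T0 c p q = (\<chi> b. \<Sum>s\<in>UNIV. p s * (\<Sum>a\<in>opt_actions c s b. q $ s $ (a, b)))"

lemma sum_opt_pairs:
  "(\<Sum>ab\<in>opt_pairs c s. f ab) = (\<Sum>b\<in>UNIV. \<Sum>a\<in>opt_actions c s b. f (a, b))"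
proof -
  have "(\<Sum>b\<in>UNIV. \<Sum>a\<in>opt_actions c s b. f (a, b))
      = (\<Sum>(b, a)\<in>(SIGMA b:UNIV. opt_actions c s b). f (a, b))"
    by (subst sum.Sigma) auto
  also have "\<dots> = (\<Sum>ab\<in>opt_pairs c s. f ab)"
    by (rule sum.reindex_bij_witness[where i = "\<lambda>(a, b). (b, a)" and j = "\<lambda>(b, a). (a, b)"])
       (auto simp: opt_pairs_def opt_actions_def)
  finally show ?thesis by simp
qed

lemma T0_in_simplex:
  assumes "\<And>s. p s > 0" and "(\<Sum>s\<in>UNIV. p s) = 1" and q: "q \<in> Delta0 c"
  shows "T0 c p q \<in> simplex_on UNIV"
proof -
  have q0: "q $ s $ ab \<ge> 0" for s ab
    using q unfolding Delta0_def simplex_on_def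
    by (cases "ab \<in> opt_pairs c s") (auto, metis order_refl surj_pair)
  have nonneg: "T0 c p q $ b \<ge> 0" for b
    unfolding T0_def
    by (simp, intro sum_nonneg mult_nonneg_nonneg q0 order.strict_implies_order[OF assms(1)])
  have "(\<Sum>b\<in>UNIV. T0 c p q $ b)
      = (\<Sum>s\<in>UNIV. p s * (\<Sum>b\<in>UNIV. \<Sum>a\<in>opt_actions c s b. q $ s $ (a, b)))"
    unfolding T0_def by (simp add: sum_distrib_left) (rule sum.swap)
  also have "\<dots> = (\<Sum>s\<in>UNIV. p s * (\<Sum>ab\<in>opt_pairs c s. q $ s $ ab))"
    by (simp add: sum_opt_pairs)
  also have "\<dots> = 1"
    using q assms(2) by (simp add: Delta0_def simplex_on_def)
  finally have total: "(\<Sum>b\<in>UNIV. T0 c p q $ b) = 1" .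
  moreover have "T0 c p q $ b \<le> (\<Sum>b\<in>UNIV. T0 c p q $ b)" for b
    by (rule member_le_sum) (auto simp: nonneg)
  ultimately show ?thesis
    using nonneg by (simp add: simplex_on_def)
qed

text \<open>
  The recurrence prescribes the coordinates in \<open>I\<^sup>s\<close>; the remaining ones vanish by the
  identification of \<open>\<Delta>\<^sub>0\<close> with a set of families of distributions on \<open>A \<times> B\<close>.
\<close>

definition generated_by_T0 ::
  "('s::finite \<Rightarrow> 'a::finite \<Rightarrow> 'b::finite \<Rightarrow> real) \<Rightarrow> ('s \<Rightarrow> real) \<Rightarrow>
   (nat \<Rightarrow> ('a, 'b, 's) family) \<Rightarrow> bool" where
  "generated_by_T0 c p q \<longleftrightarrow>
     (\<forall>n s.
        (\<forall>(a, b)\<in>opt_pairs c s.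
           q (Suc n) $ s $ (a, b)
             = T0 c p (q n) $ b / (\<Sum>(a', b')\<in>opt_pairs c s. T0 c p (q n) $ b')) \<and>
        (\<forall>ab. ab \<notin> opt_pairs c s \<longrightarrow> q (Suc n) $ s $ ab = 0))"

end

theory Submission
  imports Defs
begin

text \<open>
  The recurrence is alternating minimisation of \<open>free_energy p q \<mu>\<close>: for fixed \<open>q\<close> it is minimal at
  the marginal of \<open>q\<close>, with value \<open>g q\<close>; for fixed \<open>\<mu>\<close> it is minimal at the next iterate. Evaluating
  \<open>free_energy p r (marginal p q)\<close> in both ways, and using that relative entropy does not increase
  under marginalisation, yields the five-point inequality of Csiszar and Tusnady,
  \<open>g q' - g r \<le> KL(r, q) - KL(r, q')\<close> for a step from \<open>q\<close> to \<open>q'\<close> and any \<open>r\<close>. Together with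
  the monotonicity of \<open>g\<close>, telescoping gives the rate, and the monotonicity of \<open>KL(r, q\<^sub>n)\<close> for every minimiser \<open>r\<close>
  upgrades convergence of a subsequence to convergence of the whole sequence.
\<close>

section \<open>Relative entropy, marginals and the free energy\<close>

definition kl :: "('i::finite \<Rightarrow> real) \<Rightarrow> ('i \<Rightarrow> real) \<Rightarrow> real" where
  "kl u v = (\<Sum>i\<in>UNIV. u i * ln (u i / v i))"

definition marginal ::
  "('s::finite \<Rightarrow> real) \<Rightarrow> ('a::finite, 'b::finite, 's) family \<Rightarrow> 'b \<Rightarrow> real" where
  "marginal p q b = (\<Sum>s\<in>UNIV. p s * (\<Sum>a\<in>UNIV. q $ s $ (a, b)))"

definition family_kl ::
  "('s::finite \<Rightarrow> real) \<Rightarrow> ('a::finite, 'b::finite, 's) family \<Rightarrow> ('a, 'b, 's) family \<Rightarrow> real" where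
  "family_kl p q r = (\<Sum>s\<in>UNIV. p s * kl (\<lambda>ab. q $ s $ ab) (\<lambda>ab. r $ s $ ab))"

text \<open>The reference weight \<open>\<mu> (snd ab)\<close> is constant in the first coordinate
  and is not normalised over pairs, so the value can be negative.\<close>

definition free_energy ::
  "('s::finite \<Rightarrow> real) \<Rightarrow> ('a::finite, 'b::finite, 's) family \<Rightarrow> ('b \<Rightarrow> real) \<Rightarrow> real" where
  "free_energy p q \<mu> = (\<Sum>s\<in>UNIV. p s * kl (\<lambda>ab. q $ s $ ab) (\<lambda>ab. \<mu> (snd ab)))"

definition g_real :: "('s::finite \<Rightarrow> real) \<Rightarrow> ('a::finite, 'b::finite, 's) family \<Rightarrow> real" where
  "g_real p q = free_energy p q (marginal p q)"

definition partition_fun ::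
  "('s \<Rightarrow> 'a::finite \<Rightarrow> 'b::finite \<Rightarrow> real) \<Rightarrow> 's \<Rightarrow> ('b \<Rightarrow> real) \<Rightarrow> real" where
  "partition_fun c s \<mu> = (\<Sum>ab\<in>opt_pairs c s. \<mu> (snd ab))"

text \<open>Full support on the optimal pairs ensures that every \<open>r\<close> in
  \<open>Delta0 c\<close> is absolutely continuous with respect to \<open>q\<close>, so that
  \<open>family_kl p r q\<close> is a genuine divergence.\<close>

definition Delta0_pos ::
  "('s::finite \<Rightarrow> 'a::finite \<Rightarrow> 'b::finite \<Rightarrow> real) \<Rightarrow> ('a, 'b, 's) family set" where
  "Delta0_pos c = {q \<in> Delta0 c. \<forall>s. \<forall>ab\<in>opt_pairs c s. 0 < q $ s $ ab}"

section \<open>Elementary inequalities for relative entropy\<close>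

lemma kl_self [simp]: "kl u u = 0"
proof -
  have "u i * ln (u i / u i) = 0" for i by (cases "u i = 0") auto
  then show ?thesis unfolding kl_def by (intro sum.neutral) blast
qed

text \<open>This is \<open>ln t \<le> t - 1\<close> at \<open>t = sqrt (y / x)\<close>, multiplied
  by \<open>2 * x\<close>.\<close>

lemma entropy_term_ge_sqrt:
  fixes x y :: real
  assumes "0 \<le> x" "0 \<le> y" "0 < x \<Longrightarrow> 0 < y"
  shows "(sqrt x - sqrt y)\<^sup>2 \<le> x * ln (x / y) - x + y"
proof (cases "x = 0")
  case True
  then show ?thesis using assms by simp
next
  case False
  with assms have x: "0 < x" and y: "0 < y" by auto
  have "ln (sqrt (y / x)) \<le> sqrt (y / x) - 1"
    by (rule ln_le_minus_one) (use x y in simp)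
  then have "ln (y / x) / 2 \<le> sqrt (y / x) - 1"
    using x y by (simp add: ln_sqrt)
  moreover have "ln (x / y) = - ln (y / x)"
    using x y by (simp add: ln_div)
  ultimately have "2 - 2 * sqrt (y / x) \<le> ln (x / y)" by linarith
  then have "x * (2 - 2 * sqrt (y / x)) \<le> x * ln (x / y)"
    using x by (intro mult_left_mono) auto
  moreover have "x * sqrt (y / x) = sqrt x * sqrt y"
  proof -
    have "x * sqrt (y / x) = (sqrt x * sqrt x) * (sqrt y / sqrt x)"
      using x by (simp add: real_sqrt_divide)
    also have "\<dots> = sqrt x * sqrt y" using x by (simp del: real_sqrt_mult_self)
    finally show ?thesis .
  qed
  moreover have "(sqrt x - sqrt y)\<^sup>2 = x + y - 2 * (sqrt x * sqrt y)"
    using x y by (simp add: power2_diff)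
  ultimately show ?thesis by (simp add: algebra_simps)
qed

text \<open>Equal total masses cancel the linear terms, leaving the squared Hellinger distance as a
  lower bound. Since \<open>kl\<close> is real-valued, a term with \<open>u i > 0\<close> and
  \<open>v i = 0\<close> is not infinite; the support condition excludes it.\<close>

lemma kl_ge_sqrt:
  assumes "\<And>i. 0 \<le> u i" "\<And>i. 0 \<le> v i" "\<And>i. 0 < u i \<Longrightarrow> 0 < v i"
    and "sum u UNIV = sum v UNIV"
  shows "(\<Sum>i\<in>UNIV. (sqrt (u i) - sqrt (v i))\<^sup>2) \<le> kl u v"
proof -
  have "(\<Sum>i\<in>UNIV. (sqrt (u i) - sqrt (v i))\<^sup>2) \<le> (\<Sum>i\<in>UNIV. u i * ln (u i / v i) - u i + v i)"
    by (intro sum_mono entropy_term_ge_sqrt assms)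
  also have "\<dots> = kl u v"
    using assms(4) by (simp add: kl_def sum.distrib sum_subtractf)
  finally show ?thesis .
qed

lemma kl_nonneg:
  assumes "\<And>i. 0 \<le> u i" "\<And>i. 0 \<le> v i" "\<And>i. 0 < u i \<Longrightarrow> 0 < v i"
    and "sum u UNIV = sum v UNIV"
  shows "0 \<le> kl u v"
proof -
  have "0 \<le> (\<Sum>i\<in>UNIV. (sqrt (u i) - sqrt (v i))\<^sup>2)" by (intro sum_nonneg) simp
  also have "\<dots> \<le> kl u v" by (rule kl_ge_sqrt[OF assms])
  finally show ?thesis .
qed

text \<open>Only the point 0 requires an argument: \<open>ln t \<le> t - 1\<close> at
  \<open>t = 1 / sqrt \<bar>x\<bar>\<close> bounds the product by
  \<open>2 * sqrt \<bar>x\<bar>\<close> near 0.\<close>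

lemma isCont_x_ln_x: "isCont (\<lambda>x::real. x * ln x) x"
proof (cases "x = 0")
  case True
  have "((\<lambda>x::real. x * ln x) \<longlongrightarrow> 0) (at 0)"
  proof (rule Lim_null_comparison)
    show "((\<lambda>x::real. 2 * sqrt \<bar>x\<bar>) \<longlongrightarrow> 0) (at 0)"
      by (auto intro!: tendsto_eq_intros)
    have "norm (x * ln x) \<le> 2 * sqrt \<bar>x\<bar>" if x: "\<bar>x\<bar> < 1" for x :: real
    proof (cases "x = 0")
      case False
      let ?y = "sqrt \<bar>x\<bar>"
      have y: "0 < ?y" "?y < 1" using False x by auto
      have "ln (1 / ?y) \<le> 1 / ?y - 1" by (rule ln_le_minus_one) (use y in simp)
      then have "- ln ?y \<le> 1 / ?y" using y by (simp add: ln_div)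
      moreover have "ln ?y \<le> 0" using y by simp
      ultimately have "\<bar>ln ?y\<bar> \<le> 1 / ?y" by linarith
      \<comment> \<open>The real \<open>ln\<close> depends only on the absolute value of its
        argument, so negative \<open>x\<close> is covered as well.\<close>
      moreover have "\<bar>ln x\<bar> = 2 * \<bar>ln ?y\<bar>"
        using False ln_sqrt[of "\<bar>x\<bar>"] by (simp add: ln_real_def)
      ultimately have "\<bar>ln x\<bar> \<le> 2 * (1 / ?y)" by linarith
      then have "norm (x * ln x) \<le> \<bar>x\<bar> * (2 * (1 / ?y))"
        unfolding real_norm_def abs_mult by (rule mult_left_mono) simp
      also have "\<dots> = ?y * ?y * (2 * (1 / ?y))" by simp
      also have "\<dots> = 2 * ?y" using y by (simp del: real_sqrt_mult_self)
      finally show ?thesis .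
    qed simp
    then show "\<forall>\<^sub>F x in at (0::real). norm (x * ln x) \<le> 2 * sqrt \<bar>x\<bar>"
      unfolding eventually_at by (intro exI[of _ 1]) auto
  qed
  then show ?thesis using True by (simp add: isCont_def)
qed (auto intro!: continuous_intros)

section \<open>Geometry of \<open>Delta0\<close>\<close>

lemma opt_pairs_nonempty: "opt_pairs c s \<noteq> {}"
proof -
  have "cmin_at c s \<in> range (\<lambda>(a, b). c s a b)"
    unfolding cmin_at_def by (rule Min_in) auto
  then show ?thesis by (force simp: opt_pairs_def)
qed

text \<open>The zeros outside the optimal pairs let the sums run over all pairs, and the upper bound
  1 follows from nonnegativity and total mass 1.\<close>

lemma Delta0_iff:
  "q \<in> Delta0 c \<longleftrightarrow>
     (\<forall>s. (\<forall>ab. 0 \<le> q $ s $ ab) \<and> (\<Sum>ab\<in>UNIV. q $ s $ ab) = 1 \<and>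
          (\<forall>ab. ab \<notin> opt_pairs c s \<longrightarrow> q $ s $ ab = 0))"
proof -
  have "q $ s \<in> simplex_on (opt_pairs c s) \<longleftrightarrow>
      (\<forall>ab. 0 \<le> q $ s $ ab) \<and> (\<Sum>ab\<in>UNIV. q $ s $ ab) = 1 \<and>
          (\<forall>ab. ab \<notin> opt_pairs c s \<longrightarrow> q $ s $ ab = 0)" (is "?L \<longleftrightarrow> ?R") for s
  proof -
    have sum_eq: "(\<Sum>ab\<in>UNIV. q $ s $ ab) = (\<Sum>ab\<in>opt_pairs c s. q $ s $ ab)"
      if "\<forall>ab. ab \<notin> opt_pairs c s \<longrightarrow> q $ s $ ab = 0"
      by (rule sum.mono_neutral_right) (use that in auto)
    have "q $ s $ ab \<le> (\<Sum>ab\<in>opt_pairs c s. q $ s $ ab)"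
      if "\<forall>ab. 0 \<le> q $ s $ ab" "ab \<in> opt_pairs c s" for ab
      by (rule member_le_sum) (use that in auto)
    note le_sum = this
    show ?thesis
    proof
      assume ?L
      then have "\<forall>ab\<in>opt_pairs c s. 0 \<le> q $ s $ ab" "(\<Sum>ab\<in>opt_pairs c s. q $ s $ ab) = 1"
        and zero: "\<forall>ab. ab \<notin> opt_pairs c s \<longrightarrow> q $ s $ ab = 0"
        unfolding simplex_on_def mem_Collect_eq by blast+
      moreover from this have "0 \<le> q $ s $ ab" for ab
        by (cases "ab \<in> opt_pairs c s") (simp_all del: split_paired_All)
      ultimately show ?R using sum_eq[OF zero] by (simp del: split_paired_All)
    next
      assume R: ?R
      then have "(\<Sum>ab\<in>opt_pairs c s. q $ s $ ab) = 1"
        using sum_eq by (simp del: split_paired_All)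
      with R le_sum show ?L
        unfolding simplex_on_def mem_Collect_eq by (simp del: split_paired_All)
    qed
  qed
  then show ?thesis unfolding Delta0_def by simp
qed

lemma Delta0D:
  assumes "q \<in> Delta0 c"
  shows "0 \<le> q $ s $ ab" and "(\<Sum>ab\<in>UNIV. q $ s $ ab) = 1"
    and "ab \<notin> opt_pairs c s \<Longrightarrow> q $ s $ ab = 0"
  using assms unfolding Delta0_iff by blast+

lemma convex_Delta0: "convex (Delta0 c)"
  unfolding convex_def
  by (auto simp: Delta0_iff sum.distrib simp flip: sum_distrib_left simp del: split_paired_All)

lemma compact_Delta0:
  fixes c :: "'s::finite \<Rightarrow> 'a::finite \<Rightarrow> 'b::finite \<Rightarrow> real"
  shows "compact (Delta0 c)"
proof -
  have "norm q \<le> real (CARD('s))" if q: "q \<in> Delta0 c" for q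
  proof -
    have "norm (q $ s) \<le> 1" for s
    proof -
      have "norm (q $ s) \<le> (\<Sum>ab\<in>UNIV. \<bar>q $ s $ ab\<bar>)" by (rule norm_le_l1_cart)
      also have "\<dots> = 1" using Delta0D[OF q] by simp
      finally show ?thesis .
    qed
    have "norm q \<le> (\<Sum>s\<in>UNIV. norm (q $ s))"
      unfolding norm_vec_def by (intro L2_set_le_sum) auto
    also have "\<dots> \<le> (\<Sum>s\<in>(UNIV :: 's set). 1)"
      by (intro sum_mono) (rule \<open>norm (q $ _) \<le> 1\<close>)
    finally show ?thesis by simp
  qed
  then have "bounded (Delta0 c)" by (auto simp: bounded_iff)
  moreover have "closed (Delta0 c)"
  proof -
    have "Delta0 c = {q. \<forall>s. (\<forall>ab. 0 \<le> q $ s $ ab) \<and> (\<Sum>ab\<in>UNIV. q $ s $ ab) = 1 \<and>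
          (\<forall>ab. ab \<notin> opt_pairs c s \<longrightarrow> q $ s $ ab = 0)}"
      using Delta0_iff by blast
    also have "closed \<dots>"
      by (intro closed_Collect_all closed_Collect_conj closed_Collect_le closed_Collect_eq
            closed_Collect_imp open_Collect_const continuous_intros)
    finally show ?thesis .
  qed
  ultimately show ?thesis by (simp add: compact_eq_bounded_closed)
qed

definition uniform_family ::
  "('s::finite \<Rightarrow> 'a::finite \<Rightarrow> 'b::finite \<Rightarrow> real) \<Rightarrow> ('a, 'b, 's) family" where
  "uniform_family c =
     (\<chi> s. \<chi> ab. if ab \<in> opt_pairs c s then 1 / real (card (opt_pairs c s)) else 0)"

lemma uniform_family_in: "uniform_family c \<in> Delta0_pos c"
  using opt_pairs_nonempty[of c]
  by (auto simp: Delta0_pos_def Delta0_iff uniform_family_def card_gt_0_iff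
      sum.If_cases)

text \<open>A relative interior point can be pushed slightly past itself along the line from the
  uniform family. A vanishing coordinate on an optimal pair would become negative there.\<close>

lemma rel_interior_Delta0: "rel_interior (Delta0 c) \<subseteq> Delta0_pos c"
proof
  fix q assume q: "q \<in> rel_interior (Delta0 c)"
  then have q0: "q \<in> Delta0 c" using rel_interior_subset by blast
  have "0 < q $ s $ ab" if ab: "ab \<in> opt_pairs c s" for s ab
  proof (rule ccontr)
    assume "\<not> 0 < q $ s $ ab"
    then have z: "q $ s $ ab = 0" using Delta0D(1)[OF q0, of s ab] by linarith
    let ?u = "uniform_family c"
    have u: "?u \<in> Delta0 c" "0 < ?u $ s $ ab"
      using uniform_family_in[of c] ab by (auto simp: Delta0_pos_def)
    obtain m where m: "m > 1" "\<forall>e. e > 1 \<and> e \<le> m \<longrightarrow> (1 - e) *\<^sub>R ?u + e *\<^sub>R q \<in> Delta0 c"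
      using convex_rel_interior_if[OF convex_Delta0 q] u(1) hull_inc by metis
    then have "(1 - m) *\<^sub>R ?u + m *\<^sub>R q \<in> Delta0 c" by auto
    from Delta0D(1)[OF this, of s ab] have "0 \<le> (1 - m) * ?u $ s $ ab" using z by simp
    then show False using m(1) u(2) by (simp add: zero_le_mult_iff)
  qed
  then show "q \<in> Delta0_pos c" using q0 by (auto simp: Delta0_pos_def)
qed

section \<open>Marginals, and \<open>g\<close> as a finite continuous function on
  \<open>Delta0\<close>\<close>

lemma sum_marginal:
  "(\<Sum>s\<in>UNIV. p s * (\<Sum>ab\<in>UNIV. q $ s $ ab * f (snd ab))) = (\<Sum>b\<in>UNIV. marginal p q b * f b)"
proof -
  have "(\<Sum>ab\<in>UNIV. q $ s $ ab * f (snd ab)) = (\<Sum>b\<in>UNIV. \<Sum>a\<in>UNIV. q $ s $ (a, b) * f b)" for s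
    by (subst sum.swap) (simp add: sum.cartesian_product case_prod_unfold)
  then show ?thesis
    by (simp add: marginal_def sum_distrib_left sum_distrib_right mult.assoc)
       (rule sum.swap)
qed

lemma T0_eq_marginal:
  assumes "q \<in> Delta0 c"
  shows "T0 c p q $ b = marginal p q b"
proof -
  have "(\<Sum>a\<in>opt_actions c s b. q $ s $ (a, b)) = (\<Sum>a\<in>UNIV. q $ s $ (a, b))" for s
    by (rule sum.mono_neutral_left)
       (use Delta0D(3)[OF assms] in \<open>auto simp: opt_actions_def opt_pairs_def\<close>)
  then show ?thesis by (simp add: T0_def marginal_def)
qed

context
  fixes c :: "'s::finite \<Rightarrow> 'a::finite \<Rightarrow> 'b::finite \<Rightarrow> real" and p :: "'s \<Rightarrow> real"
  assumes p_pos: "\<And>s. p s > 0" and p_sum: "(\<Sum>s\<in>UNIV. p s) = 1"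
begin

lemma marginal_nonneg: "q \<in> Delta0 c \<Longrightarrow> 0 \<le> marginal p q b"
  unfolding marginal_def
  by (intro sum_nonneg mult_nonneg_nonneg Delta0D(1) less_imp_le[OF p_pos])

lemma marginal_sum: "q \<in> Delta0 c \<Longrightarrow> (\<Sum>b\<in>UNIV. marginal p q b) = 1"
  using sum_marginal[of p q "\<lambda>_. 1"] by (simp add: Delta0D(2) p_sum)

lemma marginal_pos:
  assumes q: "q \<in> Delta0 c" and pos: "0 < q $ s $ ab"
  shows "0 < marginal p q (snd ab)"
proof -
  have "0 < p s * q $ s $ ab" using p_pos pos by simp
  also have "\<dots> \<le> p s * (\<Sum>a\<in>UNIV. q $ s $ (a, snd ab))"
    using member_le_sum[of "fst ab" UNIV "\<lambda>a. q $ s $ (a, snd ab)"] Delta0D(1)[OF q] p_pos[of s]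
    by (intro mult_left_mono) auto
  also have "\<dots> \<le> marginal p q (snd ab)"
    unfolding marginal_def
    by (rule member_le_sum[where f = "\<lambda>s. p s * (\<Sum>a\<in>UNIV. q $ s $ (a, snd ab))"])
       (auto intro!: mult_nonneg_nonneg sum_nonneg Delta0D(1)[OF q] less_imp_le[OF p_pos])
  finally show ?thesis .
qed

text \<open>The infinite branch of \<open>psi\<close> is never reached on \<open>Delta0 c\<close>,
  because a positive coordinate forces a positive marginal.\<close>

lemma g_eq_g_real:
  assumes q: "q \<in> Delta0 c"
  shows "g p q = ereal (g_real p q)"
proof -
  have mu: "(\<Sum>a'\<in>UNIV. \<Sum>s'\<in>UNIV. p s' * q $ s' $ (a', b)) = marginal p q b" for b
    unfolding marginal_def by (subst sum.swap) (simp add: sum_distrib_left)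
  have psi: "psi (q $ s $ (a, b)) (marginal p q b)
      = ereal (q $ s $ (a, b) * ln (q $ s $ (a, b) / marginal p q b))" for s a b
    using Delta0D(1)[OF q, of s "(a, b)"] marginal_pos[OF q, of s "(a, b)"] marginal_nonneg[OF q, of b]
    by (auto simp: psi_def)
  have "g p q = (\<Sum>s\<in>UNIV. ereal (p s) *
      (\<Sum>a\<in>UNIV. \<Sum>b\<in>UNIV. ereal (q $ s $ (a, b) * ln (q $ s $ (a, b) / marginal p q b))))"
    using Delta0D(1)[OF q] by (simp add: g_def mu psi)
  also have "\<dots> = ereal (g_real p q)"
    by (simp add: g_real_def free_energy_def kl_def sum.cartesian_product case_prod_unfold)
  finally show ?thesis .
qed

text \<open>Splitting the logarithm leaves only terms of the form \<open>x * ln x\<close>, which are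
  continuous up to the boundary, unlike the quotients inside \<open>ln\<close>.\<close>

lemma g_real_eq_entropies:
  assumes q: "q \<in> Delta0 c"
  shows "g_real p q = (\<Sum>s\<in>UNIV. p s * (\<Sum>ab\<in>UNIV. q $ s $ ab * ln (q $ s $ ab)))
    - (\<Sum>b\<in>UNIV. marginal p q b * ln (marginal p q b))"
proof -
  have "q $ s $ ab * ln (q $ s $ ab / marginal p q (snd ab))
      = q $ s $ ab * ln (q $ s $ ab) - q $ s $ ab * ln (marginal p q (snd ab))" for s ab
    using Delta0D(1)[OF q, of s ab] marginal_pos[OF q, of s ab]
    by (cases "q $ s $ ab = 0") (auto simp: ln_div algebra_simps)
  then show ?thesis
    by (simp add: g_real_def free_energy_def kl_def sum_subtractf right_diff_distrib
        sum_marginal[where f = "\<lambda>b. ln (marginal p q b)"])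
qed

lemma continuous_on_g_real: "continuous_on (Delta0 c) (g_real p)"
proof -
  have xlx: "continuous_on X (\<lambda>x. f x * ln (f x))" if "continuous_on X f"
    for X and f :: "('a, 'b, 's) family \<Rightarrow> real"
    using continuous_on_compose2[OF continuous_at_imp_continuous_on[of UNIV "\<lambda>x::real. x * ln x"] that]
    by (auto simp: isCont_x_ln_x)
  have "continuous_on (Delta0 c) (\<lambda>q. (\<Sum>s\<in>UNIV. p s * (\<Sum>ab\<in>UNIV. q $ s $ ab * ln (q $ s $ ab)))
    - (\<Sum>b\<in>UNIV. marginal p q b * ln (marginal p q b)))"
    by (intro continuous_on_diff continuous_on_sum continuous_on_mult_left xlx)
       (auto simp: marginal_def intro!: continuous_intros)
  then show ?thesis
    by (rule continuous_on_eq) (simp add: g_real_eq_entropies)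
qed

lemma Z0_iff: "q \<in> Z0 c p \<longleftrightarrow> q \<in> Delta0 c \<and> (\<forall>r\<in>Delta0 c. g_real p q \<le> g_real p r)"
  unfolding Z0_def is_arg_min_def by (auto simp: g_eq_g_real not_less)

lemma Z0_nonempty: "Z0 c p \<noteq> {}"
proof -
  have "Delta0 c \<noteq> {}" using uniform_family_in[of c] by (auto simp: Delta0_pos_def)
  then show ?thesis
    using continuous_attains_inf[OF compact_Delta0 _ continuous_on_g_real] by (force simp: Z0_iff)
qed

section \<open>Chain rule for the free energy and contraction of divergence\<close>

lemma free_energy_eq_marginal:
  assumes r: "r \<in> Delta0 c" and q: "q \<in> Delta0_pos c"
  shows "free_energy p r (marginal p q) = g_real p r + kl (marginal p r) (marginal p q)"
proof -
  have q0: "q \<in> Delta0 c" using q by (simp add: Delta0_pos_def)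
  \<comment> \<open>The marginal of \<open>r\<close> is inserted as an intermediate reference. The
    second logarithm depends on \<open>snd ab\<close> only, so its average reduces to a divergence
    of marginals.\<close>
  have "r $ s $ ab * ln (r $ s $ ab / marginal p q (snd ab))
      = r $ s $ ab * ln (r $ s $ ab / marginal p r (snd ab))
        + r $ s $ ab * ln (marginal p r (snd ab) / marginal p q (snd ab))" for s ab
  proof (cases "r $ s $ ab = 0")
    case False
    then have "0 < r $ s $ ab" "0 < q $ s $ ab"
      using Delta0D(1)[OF r, of s ab] Delta0D(3)[OF r, of ab s] q by (auto simp: Delta0_pos_def less_le)
    then have "0 < marginal p r (snd ab)" "0 < marginal p q (snd ab)"
      using marginal_pos[OF r, of s ab] marginal_pos[OF q0, of s ab] by auto
    then have "ln (r $ s $ ab / marginal p q (snd ab))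
        = ln (r $ s $ ab / marginal p r (snd ab)) + ln (marginal p r (snd ab) / marginal p q (snd ab))"
      using \<open>0 < r $ s $ ab\<close> by (simp add: ln_div)
    then show ?thesis by (simp only: distrib_left)
  qed simp
  then have "free_energy p r (marginal p q) = g_real p r
      + (\<Sum>s\<in>UNIV. p s * (\<Sum>ab\<in>UNIV. r $ s $ ab * ln (marginal p r (snd ab) / marginal p q (snd ab))))"
    by (simp add: g_real_def free_energy_def kl_def sum.distrib distrib_left)
  then show ?thesis
    by (simp add: sum_marginal[where f = "\<lambda>b. ln (marginal p r b / marginal p q b)"] kl_def)
qed

text \<open>Data processing inequality. The bound \<open>ln z \<le> z - 1\<close> is applied
  coordinatewise to the ratio of \<open>q\<close>, reweighted by \<open>?t\<close>, to
  \<open>r\<close>; the marginal of the reweighted \<open>q\<close> is dominated by that of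
  \<open>r\<close>.\<close>

lemma kl_marginal_le:
  assumes r: "r \<in> Delta0 c" and q: "q \<in> Delta0_pos c"
  shows "kl (marginal p r) (marginal p q) \<le> family_kl p r q"
proof -
  have q0: "q \<in> Delta0 c" using q by (simp add: Delta0_pos_def)
  let ?t = "\<lambda>b. marginal p r b / marginal p q b"
  have "r $ s $ ab * ln (?t (snd ab)) + r $ s $ ab - q $ s $ ab * ?t (snd ab)
      \<le> r $ s $ ab * ln (r $ s $ ab / q $ s $ ab)" for s ab
  proof (cases "r $ s $ ab = 0")
    case True
    then show ?thesis
      using Delta0D(1)[OF q0] marginal_nonneg[OF r] marginal_nonneg[OF q0] by simp
  next
    case False
    then have pos: "0 < r $ s $ ab" "0 < q $ s $ ab"
      using Delta0D(1)[OF r, of s ab] Delta0D(3)[OF r, of ab s] q by (auto simp: Delta0_pos_def less_le)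
    then have m: "0 < marginal p r (snd ab)" "0 < marginal p q (snd ab)"
      using marginal_pos[OF r, of s ab] marginal_pos[OF q0, of s ab] by auto
    let ?z = "q $ s $ ab * ?t (snd ab) / r $ s $ ab"
    have "ln ?z \<le> ?z - 1" by (rule ln_le_minus_one) (use pos m in simp)
    then have "r $ s $ ab * ln ?z \<le> r $ s $ ab * (?z - 1)"
      using pos by (intro mult_left_mono) auto
    also have "\<dots> = q $ s $ ab * ?t (snd ab) - r $ s $ ab"
      using pos by (simp add: algebra_simps)
    finally show ?thesis
      using pos m by (simp add: ln_div ln_mult algebra_simps)
  qed
  then have "(\<Sum>s\<in>UNIV. p s * (\<Sum>ab\<in>UNIV. r $ s $ ab * ln (?t (snd ab)) + r $ s $ ab
      - q $ s $ ab * ?t (snd ab))) \<le> family_kl p r q"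
    unfolding family_kl_def kl_def
    by (intro sum_mono mult_left_mono less_imp_le[OF p_pos])
  then have "kl (marginal p r) (marginal p q) + 1 - (\<Sum>b\<in>UNIV. marginal p q b * ?t b)
      \<le> family_kl p r q"
    using sum_marginal[of p r "\<lambda>b. ln (?t b)"] sum_marginal[of p q ?t]
    by (simp add: sum.distrib sum_subtractf distrib_left right_diff_distrib kl_def p_sum
        Delta0D(2)[OF r] del: times_divide_eq_right)
  \<comment> \<open>Where the marginal of \<open>q\<close> vanishes the left term is 0; elsewhere
    the two terms agree.\<close>
  moreover have "(\<Sum>b\<in>UNIV. marginal p q b * ?t b) \<le> (\<Sum>b\<in>UNIV. marginal p r b)"
    by (intro sum_mono) (auto simp: marginal_nonneg[OF r])
  ultimately show ?thesis by (simp add: marginal_sum[OF r])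
qed

text \<open>All contributions to the Hellinger bound are nonnegative, so a single coordinate can be
  isolated with its weight \<open>p s\<close>.\<close>

lemma family_kl_ge_sqrt:
  assumes r: "r \<in> Delta0 c" and q: "q \<in> Delta0_pos c"
  shows "p s * (sqrt (r $ s $ ab) - sqrt (q $ s $ ab))\<^sup>2 \<le> family_kl p r q"
proof -
  have q0: "q \<in> Delta0 c" using q by (simp add: Delta0_pos_def)
  have pos: "0 < q $ s $ ab" if "0 < r $ s $ ab" for s ab
    using that q Delta0D(3)[OF r, of ab s] by (force simp: Delta0_pos_def)
  have ge: "(\<Sum>ab\<in>UNIV. (sqrt (r $ s $ ab) - sqrt (q $ s $ ab))\<^sup>2)
      \<le> kl (\<lambda>ab. r $ s $ ab) (\<lambda>ab. q $ s $ ab)" for s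
    by (rule kl_ge_sqrt) (simp_all add: Delta0D(1,2)[OF r] Delta0D(1,2)[OF q0] pos)
  have "(sqrt (r $ s $ ab) - sqrt (q $ s $ ab))\<^sup>2
      \<le> (\<Sum>ab\<in>UNIV. (sqrt (r $ s $ ab) - sqrt (q $ s $ ab))\<^sup>2)"
    by (rule member_le_sum) auto
  also note ge
  finally have "p s * (sqrt (r $ s $ ab) - sqrt (q $ s $ ab))\<^sup>2
      \<le> p s * kl (\<lambda>ab. r $ s $ ab) (\<lambda>ab. q $ s $ ab)"
    using p_pos[of s] by (intro mult_left_mono) auto
  also have "\<dots> \<le> family_kl p r q"
    unfolding family_kl_def
    by (rule member_le_sum[where f = "\<lambda>s. p s * kl (\<lambda>ab. r $ s $ ab) (\<lambda>ab. q $ s $ ab)"])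
       (auto intro!: mult_nonneg_nonneg less_imp_le[OF p_pos] order.trans[OF sum_nonneg ge])
  finally show ?thesis .
qed

lemma family_kl_nonneg: "r \<in> Delta0 c \<Longrightarrow> q \<in> Delta0_pos c \<Longrightarrow> 0 \<le> family_kl p r q"
  \<comment> \<open>Any coordinate serves here; \<open>undefined\<close> just names one.\<close>
  by (rule order.trans[OF _ family_kl_ge_sqrt[of r q undefined undefined]])
     (simp_all add: less_imp_le[OF p_pos])

lemma family_kl_self [simp]: "family_kl p q q = 0"
  by (simp add: family_kl_def)

section \<open>One step of the recurrence\<close>

definition is_step :: "('a, 'b, 's) family \<Rightarrow> ('a, 'b, 's) family \<Rightarrow> bool" where
  "is_step q q' \<longleftrightarrow> (\<forall>s ab. q' $ s $ ab =
     (if ab \<in> opt_pairs c s then marginal p q (snd ab) / partition_fun c s (marginal p q) else 0))"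

lemma is_stepD:
  assumes "is_step q q'"
  shows "q' $ s $ ab =
    (if ab \<in> opt_pairs c s then marginal p q (snd ab) / partition_fun c s (marginal p q) else 0)"
  using assms unfolding is_step_def by blast

lemma partition_fun_pos:
  assumes q: "q \<in> Delta0_pos c"
  shows "0 < partition_fun c s (marginal p q)"
proof -
  have "0 < marginal p q (snd ab)" if "ab \<in> opt_pairs c s" for ab
    using that q marginal_pos[of q s ab] by (simp add: Delta0_pos_def)
  then show ?thesis
    unfolding partition_fun_def by (intro sum_pos opt_pairs_nonempty) auto
qed

lemma is_step_in:
  assumes q: "q \<in> Delta0_pos c" and step: "is_step q q'"
  shows "q' \<in> Delta0_pos c"
proof -
  have q0: "q \<in> Delta0 c" using q by (simp add: Delta0_pos_def)
  note D = partition_fun_pos[OF q]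
  have "(\<Sum>ab\<in>UNIV. q' $ s $ ab) = 1" for s
  proof -
    have "(\<Sum>ab\<in>UNIV. q' $ s $ ab)
        = (\<Sum>ab\<in>opt_pairs c s. marginal p q (snd ab) / partition_fun c s (marginal p q))"
      by (simp add: is_stepD[OF step] sum.If_cases)
    also have "\<dots> = 1"
      using D[of s] by (simp add: partition_fun_def flip: sum_divide_distrib)
    finally show ?thesis .
  qed
  then have "q' \<in> Delta0 c"
    using marginal_nonneg[OF q0] less_imp_le[OF D]
    by (auto simp: Delta0_iff is_stepD[OF step] simp del: split_paired_All)
  moreover have "0 < q' $ s $ ab" if "ab \<in> opt_pairs c s" for s ab
    using that q D marginal_pos[OF q0, of s ab] by (simp add: is_stepD[OF step] Delta0_pos_def)
  ultimately show ?thesis by (simp add: Delta0_pos_def)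
qed

text \<open>
  Minimising \<open>free_energy\<close> in its first argument is a projection onto a Gibbs family,
  whose minimal value is the negative logarithm of the partition function.
\<close>

lemma free_energy_eq_step:
  assumes r: "r \<in> Delta0 c" and q: "q \<in> Delta0_pos c" and step: "is_step q q'"
  shows "free_energy p r (marginal p q)
    = family_kl p r q' - (\<Sum>s\<in>UNIV. p s * ln (partition_fun c s (marginal p q)))"
proof -
  have q0: "q \<in> Delta0 c" using q by (simp add: Delta0_pos_def)
  let ?D = "\<lambda>s. partition_fun c s (marginal p q)"
  have "r $ s $ ab * ln (r $ s $ ab / marginal p q (snd ab))
      = r $ s $ ab * ln (r $ s $ ab / q' $ s $ ab) - r $ s $ ab * ln (?D s)" for s ab
  proof (cases "r $ s $ ab = 0")
    case False
    then have ab: "ab \<in> opt_pairs c s" and "0 < r $ s $ ab" "0 < q $ s $ ab"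
      using Delta0D(1)[OF r, of s ab] Delta0D(3)[OF r, of ab s] q by (auto simp: Delta0_pos_def less_le)
    then show ?thesis
      using marginal_pos[OF q0, of s ab] partition_fun_pos[OF q, of s]
      by (simp add: is_stepD[OF step] ln_div ln_mult algebra_simps)
  qed simp
  then have "kl (\<lambda>ab. r $ s $ ab) (\<lambda>ab. marginal p q (snd ab))
      = kl (\<lambda>ab. r $ s $ ab) (\<lambda>ab. q' $ s $ ab) - ln (?D s)" for s
    by (simp add: kl_def sum_subtractf Delta0D(2)[OF r] flip: sum_distrib_right)
  then show ?thesis
    by (simp add: free_energy_def family_kl_def sum_subtractf right_diff_distrib)
qed

text \<open>The two expansions of the free energy combine into the identity \<open>eq\<close>. At
  \<open>q'\<close> and at \<open>q\<close> it places \<open>?L\<close> between the two values of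
  \<open>g_real\<close>; at a general \<open>r\<close>, together with \<open>kl_marginal_le\<close>,
  it gives the five-point inequality.\<close>

lemma
  assumes q: "q \<in> Delta0_pos c" and step: "is_step q q'"
  shows step_decrease: "g_real p q' \<le> g_real p q"
    and step_five_point:
      "r \<in> Delta0 c \<Longrightarrow> g_real p q' - g_real p r \<le> family_kl p r q - family_kl p r q'"
proof -
  have q0: "q \<in> Delta0 c" using q by (simp add: Delta0_pos_def)
  have q': "q' \<in> Delta0_pos c" by (rule is_step_in[OF q step])
  then have q'0: "q' \<in> Delta0 c" by (simp add: Delta0_pos_def)
  \<comment> \<open>\<open>?L\<close> is the minimum over \<open>Delta0 c\<close> of the free energy
    with second argument \<open>marginal p q\<close>, attained at \<open>q'\<close>.\<close>
  let ?L = "- (\<Sum>s\<in>UNIV. p s * ln (partition_fun c s (marginal p q)))"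
  have eq: "g_real p r + kl (marginal p r) (marginal p q) = family_kl p r q' + ?L"
    if "r \<in> Delta0 c" for r
    using free_energy_eq_step[OF that q step] free_energy_eq_marginal[OF that q] by simp
  \<comment> \<open>Absolute continuity of the marginals: mass of \<open>q'\<close> over
    \<open>b\<close> sits on an optimal pair, where \<open>q\<close> is positive.\<close>
  have "0 < marginal p q b" if "0 < marginal p q' b" for b
  proof -
    have "\<exists>s a. q' $ s $ (a, b) \<noteq> 0"
      using that by (rule contrapos_pp) (simp add: marginal_def)
    then obtain s a where "q' $ s $ (a, b) \<noteq> 0" by blast
    then have "(a, b) \<in> opt_pairs c s" using Delta0D(3)[OF q'0] by blast
    then show ?thesis
      using marginal_pos[OF q0, of s "(a, b)"] q by (simp add: Delta0_pos_def)
  qed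
  then have "0 \<le> kl (marginal p q') (marginal p q)"
    by (intro kl_nonneg) (auto simp: marginal_nonneg q0 q'0 marginal_sum)
  then have le_L: "g_real p q' \<le> ?L" using eq[OF q'0] by simp
  moreover have "?L \<le> g_real p q"
    using eq[OF q0] family_kl_nonneg[OF q0 q'] by simp
  ultimately show "g_real p q' \<le> g_real p q" by linarith
  show "g_real p q' - g_real p r \<le> family_kl p r q - family_kl p r q'" if "r \<in> Delta0 c"
    using eq[OF that] le_L kl_marginal_le[OF that q] by linarith
qed

lemma generated_is_step:
  assumes gen: "generated_by_T0 c p q" and q: "q n \<in> Delta0 c"
  shows "is_step (q n) (q (Suc n))"
  unfolding is_step_def
proof (intro allI)
  fix s ab
  show "q (Suc n) $ s $ ab = (if ab \<in> opt_pairs c s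
      then marginal p (q n) (snd ab) / partition_fun c s (marginal p (q n)) else 0)"
    using gen unfolding generated_by_T0_def
    by (cases ab) (auto simp: T0_eq_marginal[OF q] partition_fun_def case_prod_unfold)
qed

section \<open>Convergence in divergence and convergence of coordinates\<close>

lemma tendsto_family_kl_self:
  assumes "(f \<longlongrightarrow> r) F"
  shows "((\<lambda>n. family_kl p r (f n)) \<longlongrightarrow> 0) F"
proof -
  have "((\<lambda>n. r $ s $ ab * ln (r $ s $ ab / f n $ s $ ab)) \<longlongrightarrow> r $ s $ ab * ln (r $ s $ ab / r $ s $ ab)) F"
    for s ab
  \<comment> \<open>A zero coordinate of \<open>r\<close> contributes 0 for every \<open>n\<close>;
    elsewhere the quotient tends to 1, where \<open>ln\<close> is continuous.\<close>
  proof (cases "r $ s $ ab = 0")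
    case False
    then show ?thesis
      by (intro tendsto_intros tendsto_vec_nth assms) auto
  qed simp
  then have "((\<lambda>n. kl (\<lambda>ab. r $ s $ ab) (\<lambda>ab. f n $ s $ ab))
      \<longlongrightarrow> kl (\<lambda>ab. r $ s $ ab) (\<lambda>ab. r $ s $ ab)) F" for s
    unfolding kl_def by (rule tendsto_sum)
  then have "((\<lambda>n. family_kl p r (f n)) \<longlongrightarrow> family_kl p r r) F"
    unfolding family_kl_def by (intro tendsto_sum tendsto_mult_left)
  then show ?thesis by simp
qed

text \<open>The divergence dominates squared differences of square roots, so the square roots of the
  coordinates converge, and squaring recovers the coordinates.\<close>

lemma tendsto_of_family_kl:
  assumes r: "r \<in> Delta0 c" and f: "\<And>n. f n \<in> Delta0_pos c"
    and lim: "((\<lambda>n. family_kl p r (f n)) \<longlongrightarrow> 0) F"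
  shows "(f \<longlongrightarrow> r) F"
proof (intro vec_tendstoI)
  fix s ab
  have f0: "f n \<in> Delta0 c" for n using f[of n] by (simp add: Delta0_pos_def)
  have "((\<lambda>n. (sqrt (r $ s $ ab) - sqrt (f n $ s $ ab))\<^sup>2) \<longlongrightarrow> 0) F"
  proof (rule Lim_null_comparison)
    show "((\<lambda>n. family_kl p r (f n) / p s) \<longlongrightarrow> 0) F"
      using tendsto_divide[OF lim tendsto_const[of "p s"]] p_pos[of s] by simp
    show "\<forall>\<^sub>F n in F. norm ((sqrt (r $ s $ ab) - sqrt (f n $ s $ ab))\<^sup>2) \<le> family_kl p r (f n) / p s"
      using family_kl_ge_sqrt[OF r f, of s ab] p_pos[of s]
      by (intro always_eventually) (simp add: field_simps)
  qed
  then have "((\<lambda>n. sqrt (r $ s $ ab) - sqrt (f n $ s $ ab)) \<longlongrightarrow> 0) F"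
    by simp
  from tendsto_diff[OF tendsto_const[of "sqrt (r $ s $ ab)"] this]
  have "((\<lambda>n. sqrt (f n $ s $ ab)) \<longlongrightarrow> sqrt (r $ s $ ab)) F" by simp
  from tendsto_power[OF this, of 2]
  show "((\<lambda>n. f n $ s $ ab) \<longlongrightarrow> r $ s $ ab) F"
    by (simp add: Delta0D(1)[OF r] Delta0D(1)[OF f0])
qed

section \<open>Rate and convergence of the iteration\<close>

context
  fixes q :: "nat \<Rightarrow> ('a, 'b, 's) family"
  assumes init: "q 0 \<in> Delta0_pos c" and gen: "generated_by_T0 c p q"
begin

lemma iterate_in: "q n \<in> Delta0_pos c"
proof (induction n)
  case (Suc n)
  then show ?case
    using is_step_in[OF Suc generated_is_step[OF gen]] unfolding Delta0_pos_def by blast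
qed (rule init)

lemma iterate_in_Delta0: "q n \<in> Delta0 c"
  using iterate_in[of n] by (simp add: Delta0_pos_def)

lemmas iterate_step = generated_is_step[OF gen iterate_in_Delta0]

text \<open>Telescoping in inductive form: the drop in divergence pays for one new gap, while
  monotonicity of the values lowers the \<open>n\<close> earlier gaps to the current one. Keeping
  the remaining divergence on the left lets the induction close.\<close>

lemma iterate_rate:
  assumes r: "r \<in> Z0 c p"
  shows "real n * (g_real p (q n) - g_real p r) + family_kl p r (q n) \<le> family_kl p r (q 0)"
proof (induction n)
  case (Suc n)
  have "real n * (g_real p (q (Suc n)) - g_real p r) \<le> real n * (g_real p (q n) - g_real p r)"
    using step_decrease[OF iterate_in iterate_step, of n] by (intro mult_left_mono) auto
  moreover have "g_real p (q (Suc n)) - g_real p r \<le> family_kl p r (q n) - family_kl p r (q (Suc n))"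
    using step_five_point[OF iterate_in iterate_step] r by (simp add: Z0_iff)
  ultimately show ?case using Suc by (simp add: algebra_simps)
qed simp

text \<open>The gap to a minimiser is nonnegative, so the five-point inequality becomes Fejer
  monotonicity in divergence.\<close>

lemma iterate_decseq_kl:
  assumes r: "r \<in> Z0 c p"
  shows "decseq (\<lambda>n. family_kl p r (q n))"
proof (rule decseq_SucI)
  fix n
  show "family_kl p r (q (Suc n)) \<le> family_kl p r (q n)"
    using step_five_point[OF iterate_in iterate_step, of r n] r iterate_in_Delta0[of "Suc n"]
    by (force simp: Z0_iff)
qed

lemma iterate_bounds:
  assumes r: "r \<in> Z0 c p" and n: "0 < n"
  shows "0 \<le> g_real p (q n) - g_real p r"
    and "g_real p (q n) - g_real p r \<le> family_kl p r (q 0) / real n"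
proof -
  show "0 \<le> g_real p (q n) - g_real p r"
    using r iterate_in_Delta0 by (auto simp: Z0_iff)
  have "real n * (g_real p (q n) - g_real p r) \<le> family_kl p r (q 0)"
    using iterate_rate[OF r, of n] family_kl_nonneg[OF _ iterate_in, of r n] r by (auto simp: Z0_iff)
  then show "g_real p (q n) - g_real p r \<le> family_kl p r (q 0) / real n"
    using n by (simp add: field_simps)
qed

lemma iterate_value_tendsto:
  assumes r: "r \<in> Z0 c p"
  shows "(\<lambda>n. g_real p (q n)) \<longlonglongrightarrow> g_real p r"
proof -
  have "(\<lambda>n. g_real p (q n) - g_real p r) \<longlonglongrightarrow> 0"
  proof (rule Lim_null_comparison)
    show "(\<lambda>n. family_kl p r (q 0) / real n) \<longlonglongrightarrow> 0" by (rule lim_const_over_n)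
    show "\<forall>\<^sub>F n in sequentially.
        norm (g_real p (q n) - g_real p r) \<le> family_kl p r (q 0) / real n"
      using eventually_gt_at_top[of 0] by eventually_elim (use iterate_bounds[OF r] in auto)
  qed
  then show ?thesis by (rule LIM_zero_cancel)
qed

text \<open>
  Any cluster point is a minimiser, and the divergence from a minimiser is monotone along the
  iteration, so it tends to zero as soon as it does so along a subsequence.
\<close>

lemma iterate_tendsto: "\<exists>r\<in>Z0 c p. q \<longlonglongrightarrow> r"
proof -
  obtain m where m: "m \<in> Z0 c p" using Z0_nonempty by blast
  obtain r \<phi> where r: "r \<in> Delta0 c" and \<phi>: "strict_mono \<phi>" and lim: "(q \<circ> \<phi>) \<longlonglongrightarrow> r"
    using compact_Delta0[of c] iterate_in_Delta0 unfolding compact_def by metis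
  have "(\<lambda>n. g_real p ((q \<circ> \<phi>) n)) \<longlonglongrightarrow> g_real p r"
    using continuous_on_tendsto_compose[OF continuous_on_g_real lim r] iterate_in_Delta0 by simp
  moreover have "(\<lambda>n. g_real p ((q \<circ> \<phi>) n)) \<longlonglongrightarrow> g_real p m"
    using LIMSEQ_subseq_LIMSEQ[OF iterate_value_tendsto[OF m] \<phi>] by (simp add: comp_def)
  ultimately have "g_real p r = g_real p m" by (rule LIMSEQ_unique)
  then have rZ: "r \<in> Z0 c p" using m r by (simp add: Z0_iff)
  have kl_sub: "((\<lambda>n. family_kl p r (q n)) \<circ> \<phi>) \<longlonglongrightarrow> 0"
    using tendsto_family_kl_self[OF lim] by (simp add: comp_def)
  obtain l where l: "(\<lambda>n. family_kl p r (q n)) \<longlonglongrightarrow> l"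
    using decseq_convergent[OF iterate_decseq_kl[OF rZ], of 0] family_kl_nonneg[OF r iterate_in]
    by blast
  have "l = 0" using LIMSEQ_unique[OF LIMSEQ_subseq_LIMSEQ[OF l \<phi>] kl_sub] .
  then have "q \<longlonglongrightarrow> r" using tendsto_of_family_kl[OF r iterate_in] l by simp
  then show ?thesis using rZ by blast
qed

lemma iterate_bigo:
  assumes r: "r \<in> Z0 c p"
  shows "(\<lambda>n. g_real p (q n) - g_real p r) \<in> O(\<lambda>n. 1 / real n)"
proof (rule bigoI)
  show "\<forall>\<^sub>F n in sequentially.
      norm (g_real p (q n) - g_real p r) \<le> family_kl p r (q 0) * norm (1 / real n)"
    \<comment> \<open>At \<open>n = 0\<close> the quotient \<open>1 / real n\<close> is 0 by
      convention, so the bound is claimed for positive \<open>n\<close> only.\<close>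
    using eventually_gt_at_top[of 0]
  proof eventually_elim
    case (elim n)
    show ?case using iterate_bounds[OF r elim] by simp
  qed
qed

end

end

theorem proposition4p2:
  fixes c :: "'s::finite \<Rightarrow> 'a::finite \<Rightarrow> 'b::finite \<Rightarrow> real"
    and p :: "'s \<Rightarrow> real"
  assumes card_A: "CARD('a) \<ge> 2"
    and p_pos: "\<And>s. p s > 0"
    and p_sum: "(\<Sum>s\<in>UNIV. p s) = 1"
    and cmin_zero: "\<And>s. cmin_at c s = 0"
    and cmax_gt: "cmax c p > cmin c p"
  shows "Z0 c p \<noteq> {} \<and>
    (\<forall>q :: nat \<Rightarrow> ('a, 'b, 's) family.
       q 0 \<in> rel_interior (Delta0 c) \<and> generated_by_T0 c p q \<longrightarrow>
       (\<exists>qbar\<in>Z0 c p.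
          q \<longlonglongrightarrow> qbar \<and>
          (\<exists>r :: nat \<Rightarrow> real.
             (\<forall>n. g p (q n) - g p qbar = ereal (r n)) \<and>
             r \<in> O(\<lambda>n. 1 / real n))))"
proof (intro conjI allI impI)
  show "Z0 c p \<noteq> {}" by (rule Z0_nonempty[OF p_pos p_sum])
  fix q :: "nat \<Rightarrow> ('a, 'b, 's) family"
  assume "q 0 \<in> rel_interior (Delta0 c) \<and> generated_by_T0 c p q"
  then have init: "q 0 \<in> Delta0_pos c" and gen: "generated_by_T0 c p q"
    using rel_interior_Delta0[of c] by auto
  note iterate_tendsto = iterate_tendsto[OF p_pos p_sum init gen]
    and iterate_in_Delta0 = iterate_in_Delta0[OF p_pos p_sum init gen]
    and iterate_bigo = iterate_bigo[OF p_pos p_sum init gen]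
  obtain qbar where qbar: "qbar \<in> Z0 c p" "q \<longlonglongrightarrow> qbar"
    using iterate_tendsto by blast
  have "qbar \<in> Delta0 c" using qbar(1) Z0_iff[OF p_pos p_sum] by blast
  then have "g p (q n) - g p qbar = ereal (g_real p (q n) - g_real p qbar)" for n
    using g_eq_g_real[where c = c, OF p_pos p_sum] iterate_in_Delta0[of n] by simp
  \<comment> \<open>Both values of \<open>g\<close> are finite on \<open>Delta0 c\<close>, so the
    extended-real difference is the real gap already estimated.\<close>
  then have "\<exists>r :: nat \<Rightarrow> real. (\<forall>n. g p (q n) - g p qbar = ereal (r n)) \<and> r \<in> O(\<lambda>n. 1 / real n)"
    using iterate_bigo[OF qbar(1)] by (intro exI[of _ "\<lambda>n. g_real p (q n) - g_real p qbar"]) simp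
  with qbar show "\<exists>qbar\<in>Z0 c p. q \<longlonglongrightarrow> qbar \<and>
      (\<exists>r :: nat \<Rightarrow> real. (\<forall>n. g p (q n) - g p qbar = ereal (r n)) \<and> r \<in> O(\<lambda>n. 1 / real n))"
    by (intro bexI[of _ qbar] conjI)
qed

end
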